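(* Let $p=q$ and let $\mu$ be a centered probability measure on $\mathbb{Z}$. Define $\psi_\mu:\mathbb{Z}\to\mathbb{R}$ by $$\psi_\mu(x)=\begin{cases} x+\dfrac{\mu(\{x+1,x+2,\dots\})}{\mu(\{x\})}, & x\in\mathrm{supp}\,\mu,\\[4pt] -1, & x\notin\mathrm{supp}\,\mu,\end{cases}$$ where $\mathrm{supp}\,\mu=\{x\in\mathbb{Z}\mid\mu(\{x\})\ne 0\}$. Suppose further that: (A1) $\psi_\mu(\mathrm{supp}\,\mu)\subset\mathbb{Z}_{\ge 0}$; (A2) the restriction of $\psi_\mu$ to $\mathrm{supp}\,\mu$ is strictly increasing. Let $T_\mu=\inf\{t\in\mathbb{Z}_{\ge 0}\mid M_t=\psi_\mu(Z_t)\}$. Then $E[T_\mu]<\infty$, the stopped process $(Z_{t\wedge T_\mu})_{t=0}^\infty$ is uniformly integrable, and $T_\mu$ embeds $\mu$ in the random walk, that is, $Z_{T_\mu}\sim\mu$ (the law of $Z_{T_\mu}$ is $\mu$).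
   Context: $\mathbb{Z}_{\ge 0}$ denotes the set of nonnegative integers. A probability measure $\mu$ on $\mathbb{Z}$ is centered if it has finite first moment and mean zero: $\sum_{x}|x|\mu(\{x\})<\infty$ and $\sum_x x\,\mu(\{x\})=0$. Let $\xi_1,\xi_2,\dots$ be i.i.d. random variables on a probability space $(\Omega,\mathcal{F},P)$ with $P(\xi_1=1)=p$, $P(\xi_1=-1)=q$, $P(\xi_1=0)=r$, where $p>0$, $q>0$ (and $r\ge 0$), $p+q+r=1$. The random walk is $Z_0=0$, $Z_{t+1}=Z_t+\xi_{t+1}$ for $t\in\mathbb{Z}_{\ge 0}$, its maximum process is $M_t=\max_{0\le s\le t}Z_s$, and the filtration is the natural one, $\mathcal{F}_t=\sigma(Z_s: s\le t)$. The infimum of the empty set is $+\infty$, and $a\wedge b=\min\{a,b\}$. *)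

theory Defs
  imports "HOL-Probability.Probability"
begin

definition centered :: "int pmf \<Rightarrow> bool" where
  "centered \<mu> \<longleftrightarrow>
     integrable (measure_pmf \<mu>) real_of_int \<and> measure_pmf.expectation \<mu> real_of_int = 0"

text \<open>The steps are indexed from 1; the value \<open>\<xi> 0\<close> is unconstrained and never used.\<close>

locale random_walk_steps = prob_space M
  for M :: "'a measure" and \<xi> :: "nat \<Rightarrow> 'a \<Rightarrow> int" and p q r :: real +
  assumes p_pos: "p > 0"
    and q_pos: "q > 0"
    and r_nonneg: "r \<ge> 0"
    and sum_one: "p + q + r = 1"
    and indep_steps: "indep_vars (\<lambda>_. count_space UNIV) \<xi> {1..}"
    and prob_up: "\<And>t. t \<ge> 1 \<Longrightarrow> prob {\<omega> \<in> space M. \<xi> t \<omega> = 1} = p"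
    and prob_down: "\<And>t. t \<ge> 1 \<Longrightarrow> prob {\<omega> \<in> space M. \<xi> t \<omega> = -1} = q"
    and prob_stay: "\<And>t. t \<ge> 1 \<Longrightarrow> prob {\<omega> \<in> space M. \<xi> t \<omega> = 0} = r"

primrec walk :: "(nat \<Rightarrow> 'a \<Rightarrow> int) \<Rightarrow> nat \<Rightarrow> 'a \<Rightarrow> int" where
  "walk \<xi> 0 \<omega> = 0"
| "walk \<xi> (Suc t) \<omega> = walk \<xi> t \<omega> + \<xi> (Suc t) \<omega>"

definition walk_max :: "(nat \<Rightarrow> 'a \<Rightarrow> int) \<Rightarrow> nat \<Rightarrow> 'a \<Rightarrow> int" where
  "walk_max \<xi> t \<omega> = Max ((\<lambda>s. walk \<xi> s \<omega>) ` {0..t})"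

definition psi :: "int pmf \<Rightarrow> int \<Rightarrow> real" where
  "psi \<mu> x =
     (if x \<in> set_pmf \<mu> then real_of_int x + measure_pmf.prob \<mu> {x + 1..} / pmf \<mu> x else - 1)"

text \<open>In \<^typ>\<open>enat\<close>, the infimum of the empty set is \<open>\<infinity>\<close>.\<close>

definition T_mu :: "(nat \<Rightarrow> 'a \<Rightarrow> int) \<Rightarrow> int pmf \<Rightarrow> 'a \<Rightarrow> enat" where
  "T_mu \<xi> \<mu> \<omega> = Inf {enat t | t. real_of_int (walk_max \<xi> t \<omega>) = psi \<mu> (walk \<xi> t \<omega>)}"

definition stopped :: "(nat \<Rightarrow> 'a \<Rightarrow> int) \<Rightarrow> ('a \<Rightarrow> enat) \<Rightarrow> nat \<Rightarrow> 'a \<Rightarrow> int" where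
  "stopped \<xi> \<tau> t \<omega> = walk \<xi> (the_enat (min (enat t) (\<tau> \<omega>))) \<omega>"

text \<open>
  The position of the walk at time \<open>\<tau>\<close> is meaningful only where \<open>\<tau> < \<infinity>\<close>, so an embedding is
  required to be almost surely finite; the value at \<open>\<tau> = \<infinity>\<close> then does not influence the law.
\<close>

definition embeds :: "'a measure \<Rightarrow> (nat \<Rightarrow> 'a \<Rightarrow> int) \<Rightarrow> ('a \<Rightarrow> enat) \<Rightarrow> int pmf \<Rightarrow> bool" where
  "embeds M \<xi> \<tau> \<mu> \<longleftrightarrow>
     (AE \<omega> in M. \<tau> \<omega> < \<infinity>) \<and>
     (\<lambda>\<omega>. walk \<xi> (the_enat (\<tau> \<omega>)) \<omega>) \<in> measurable M (count_space UNIV) \<and>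
     distr M (count_space UNIV) (\<lambda>\<omega>. walk \<xi> (the_enat (\<tau> \<omega>)) \<omega>) = measure_pmf \<mu>"

definition uniformly_integrable :: "'a measure \<Rightarrow> (nat \<Rightarrow> 'a \<Rightarrow> real) \<Rightarrow> bool" where
  "uniformly_integrable M X \<longleftrightarrow>
     (\<forall>t. X t \<in> borel_measurable M) \<and>
     ((\<lambda>K::real. SUP t. \<integral>\<^sup>+ \<omega>. ennreal \<bar>X t \<omega>\<bar> * indicator {\<omega>. \<bar>X t \<omega>\<bar> \<ge> K} \<omega> \<partial>M) \<longlongrightarrow> 0) at_top"

end

theory Submission
  imports Defs
begin

text \<open>
  The stopping rule is of Azema--Yor type: while the maximum of the walk is \<open>m\<close>, the walk is stopped
  on reaching the support point \<open>x\<close> with \<open>psi \<mu> x = m\<close>. The following points carry the proof.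

  Write \<open>d x = psi \<mu> x - x\<close>. By definition of \<open>psi\<close>, the overshoot identity
  \<open>d x * \<mu> {x} = \<mu> {x+1..}\<close> holds on the support. Together with the total mass it determines a
  distribution on the support: \<open>1 = \<mu> {..<x} + (1 + d x) * \<mu> {x}\<close> yields \<open>\<mu> {x}\<close> from the mass
  below \<open>x\<close> (\<open>pmf_eqI_overshoot\<close>).

  The mean zero assumption forces \<open>psi \<mu> x\<close> to be the number of support points below \<open>x\<close>, called
  the level of \<open>x\<close> (\<open>psi_eq_level\<close>). Indeed, as \<open>psi \<mu>\<close> is strictly increasing with values in the
  natural numbers, it is at least the level; and summing the overshoot identity over the support
  shows that \<open>d\<close> and the level have the same \<open>\<mu>\<close>-mean, hence so do \<open>psi \<mu>\<close> and the level. Consequently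
  no level is skipped and \<open>d\<close> is bounded by \<open>- bottom\<close>, where \<open>bottom\<close> is the least support point.

  Until it stops, the walk therefore stays above the support point at the level of its current
  maximum (\<open>ex_barrier\<close>), which is at most \<open>- bottom\<close> below the maximum. So \<open>- bottom\<close> consecutive
  down-steps enforce the stop, and \<open>T_mu\<close> has a geometric tail. As the walk moves by at most one
  per unit of time, \<open>T_mu\<close> is an integrable bound for the stopped walk, which gives uniform
  integrability.

  For the law, fix a support point \<open>x\<close> and bet on the next step whenever the maximum equals
  \<open>level x\<close>, until the walk stops. At time \<open>T_mu\<close> the total gain is \<open>1\<close> if the walk stops above \<open>x\<close>, it is \<open>- d x\<close> if the
  walk stops at \<open>x\<close>, and it is \<open>0\<close> otherwise (\<open>sum_gain\<close>). Its expectation is zero because the walk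
  is symmetric, so the law of the stopping place satisfies the same overshoot identity as \<open>\<mu>\<close>
  (\<open>terminal_overshoot\<close>), and it is \<open>\<mu>\<close>.
\<close>

section \<open>The target distribution\<close>

lemma psi_overshoot:
  assumes "x \<in> set_pmf \<mu>"
  shows "(psi \<mu> x - real_of_int x) * pmf \<mu> x = measure_pmf.prob \<mu> {x + 1..}"
  using assms by (simp add: psi_def set_pmf_iff)

lemma le_psi: "x \<in> set_pmf \<mu> \<Longrightarrow> real_of_int x \<le> psi \<mu> x"
  by (simp add: psi_def)

locale admissible_target =
  fixes \<mu> :: "int pmf"
  assumes centered: "centered \<mu>"
    and psi_Nats: "psi \<mu> ` set_pmf \<mu> \<subseteq> \<nat>"
    and psi_strict_mono: "strict_mono_on (set_pmf \<mu>) (psi \<mu>)"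
begin

abbreviation supp :: "int set" where "supp \<equiv> set_pmf \<mu>"

definition bottom :: int where "bottom = (LEAST x. x \<in> supp)"

definition level :: "int \<Rightarrow> nat" where "level x = card {y \<in> supp. y < x}"

lemma psi_less_iff: "x \<in> supp \<Longrightarrow> y \<in> supp \<Longrightarrow> psi \<mu> x < psi \<mu> y \<longleftrightarrow> x < y"
  using psi_strict_mono by (metis not_less_iff_gr_or_eq strict_mono_onD)

lemma psi_eq_nat: "x \<in> supp \<Longrightarrow> psi \<mu> x = real (nat \<lfloor>psi \<mu> x\<rfloor>)"
  using psi_Nats by (metis Nats_cases floor_of_nat image_subset_iff nat_int)

text \<open>Being natural, \<open>psi\<close> attains a minimum on the support, and by monotonicity it does so at the least point.\<close>

lemma ex_least_supp: "\<exists>x \<in> supp. \<forall>y \<in> supp. x \<le> y"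
proof -
  let ?f = "\<lambda>x. nat \<lfloor>psi \<mu> x\<rfloor>"
  obtain x where x: "x \<in> supp" "\<And>y. y \<in> supp \<Longrightarrow> ?f x \<le> ?f y"
    using ex_has_least_nat[of "\<lambda>x. x \<in> supp" _ ?f] set_pmf_not_empty[of \<mu>] by blast
  have "x \<le> y" if "y \<in> supp" for y
    using x(2)[OF that] psi_eq_nat[OF that] psi_eq_nat[OF x(1)] psi_less_iff[OF that x(1)] by (metis not_le of_nat_le_iff)
  with x(1) show ?thesis by blast
qed

lemma bottom_in_supp: "bottom \<in> supp" and bottom_le: "y \<in> supp \<Longrightarrow> bottom \<le> y"
proof -
  obtain x where x: "x \<in> supp" "\<And>y. y \<in> supp \<Longrightarrow> x \<le> y" using ex_least_supp by blast
  then have "bottom = x" unfolding bottom_def by (intro Least_equality) auto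
  with x show "bottom \<in> supp" "y \<in> supp \<Longrightarrow> bottom \<le> y" by auto
qed

lemma below_subset: "{y \<in> supp. y < x} \<subseteq> {bottom..<x}"
  using bottom_le by auto

lemma finite_below: "finite {y \<in> supp. y < x}"
  using below_subset finite_subset by blast

lemma level_le: "x \<in> supp \<Longrightarrow> int (level x) \<le> x - bottom"
  using card_mono[OF _ below_subset, of x] bottom_le[of x] by (simp add: level_def)

lemma level_less: "x \<in> supp \<Longrightarrow> x < y \<Longrightarrow> level x < level y"
  unfolding level_def by (rule psubset_card_mono[OF finite_below]) auto

lemma level_bottom: "level bottom = 0"
proof -
  have "{y \<in> supp. y < bottom} = {}" using bottom_le by force
  then show ?thesis unfolding level_def by (simp only: card.empty)
qed

text \<open>The support points below \<open>x\<close> have distinct natural numbers below \<open>psi \<mu> x\<close> as values of \<open>psi\<close>.\<close>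

lemma level_le_psi:
  assumes x: "x \<in> supp" shows "real (level x) \<le> psi \<mu> x"
proof -
  let ?f = "\<lambda>x. nat \<lfloor>psi \<mu> x\<rfloor>"
  have less: "?f y < ?f z" if "y \<in> supp" "z \<in> supp" "y < z" for y z
    using psi_less_iff[OF that(1,2)] that psi_eq_nat by (metis of_nat_less_iff)
  have inj: "inj_on ?f {y \<in> supp. y < x}"
    by (rule inj_onI) (metis (mono_tags, lifting) less less_irrefl linorder_less_linear mem_Collect_eq)
  have "?f ` {y \<in> supp. y < x} \<subseteq> {..<?f x}" using less x by auto
  from card_mono[OF _ this] have "level x \<le> ?f x" by (simp add: level_def card_image[OF inj])
  then show ?thesis using psi_eq_nat[OF x] by simp
qed

text \<open>By the overshoot identity the left side is the mass of all pairs \<open>x < y\<close> with \<open>x\<close> in the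
  support and \<open>y\<close> distributed by \<open>\<mu>\<close>; summing over \<open>x\<close> first counts the support points below \<open>y\<close>.\<close>

lemma nn_integral_overshoot:
  "(\<integral>\<^sup>+ x. ennreal (psi \<mu> x - x) \<partial>measure_pmf \<mu>) = (\<integral>\<^sup>+ x. ennreal (level x) \<partial>measure_pmf \<mu>)"
proof -
  interpret pair_sigma_finite "count_space (UNIV :: int set)" "measure_pmf \<mu>"
    by (simp add: pair_sigma_finite_def sigma_finite_measure_count_space measure_pmf.sigma_finite_measure_axioms)
  have "(\<integral>\<^sup>+ x. ennreal (psi \<mu> x - x) \<partial>measure_pmf \<mu>) =
      (\<integral>\<^sup>+ x. (\<integral>\<^sup>+ y. indicator {(x, y). x \<in> supp \<and> x < y} (x, y) \<partial>measure_pmf \<mu>) \<partial>count_space UNIV)"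
  proof (subst nn_integral_measure_pmf, rule nn_integral_cong)
    fix x
    have "ennreal (pmf \<mu> x) * ennreal (psi \<mu> x - x) = emeasure (measure_pmf \<mu>) (if x \<in> supp then {x + 1..} else {})"
    proof (cases "x \<in> supp")
      case True
      then show ?thesis
        using psi_overshoot[OF True] by (simp add: ennreal_mult'[symmetric] mult.commute measure_pmf.emeasure_eq_measure)
    next
      case False
      then show ?thesis by (simp add: set_pmf_iff)
    qed
    also have "\<dots> = (\<integral>\<^sup>+ y. indicator (if x \<in> supp then {x + 1..} else {}) y \<partial>measure_pmf \<mu>)"
      by simp
    also have "\<dots> = (\<integral>\<^sup>+ y. indicator {(x, y). x \<in> supp \<and> x < y} (x, y) \<partial>measure_pmf \<mu>)"
      by (intro nn_integral_cong) (auto simp: indicator_def)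
    finally show "ennreal (pmf \<mu> x) * ennreal (psi \<mu> x - x) = \<dots>" .
  qed
  also have "\<dots> = (\<integral>\<^sup>+ y. (\<integral>\<^sup>+ x. indicator {(x, y). x \<in> supp \<and> x < y} (x, y) \<partial>count_space UNIV) \<partial>measure_pmf \<mu>)"
    by (rule Fubini'[symmetric]) simp
  also have "\<dots> = (\<integral>\<^sup>+ y. ennreal (level y) \<partial>measure_pmf \<mu>)"
  proof (rule nn_integral_cong)
    fix y
    have "(\<integral>\<^sup>+ x. indicator {(x, y). x \<in> supp \<and> x < y} (x, y) \<partial>count_space UNIV) =
        (\<integral>\<^sup>+ x. indicator {x \<in> supp. x < y} x \<partial>count_space UNIV)"
      by (intro nn_integral_cong) (auto simp: indicator_def)
    also have "\<dots> = ennreal (level y)"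
      using finite_below[of y] by (simp add: level_def ennreal_of_nat_eq_real_of_nat)
    finally show "(\<integral>\<^sup>+ x. indicator {(x, y). x \<in> supp \<and> x < y} (x, y) \<partial>count_space UNIV) = ennreal (level y)" .
  qed
  finally show ?thesis .
qed

text \<open>Since \<open>\<mu>\<close> has mean zero, \<open>psi \<mu> x\<close> has the same expectation as the overshoot \<open>psi \<mu> x - x\<close>, which is that of the
  level. As \<open>psi \<mu>\<close> dominates the level, they agree wherever \<open>\<mu>\<close> has mass. The level is integrable since it grows
  at most linearly.\<close>

lemma psi_eq_level:
  assumes x: "x \<in> supp"
  shows "psi \<mu> x = real (level x)"
proof -
  have intX: "integrable (measure_pmf \<mu>) real_of_int" and EX: "measure_pmf.expectation \<mu> real_of_int = 0"
    using centered by (auto simp: centered_def)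
  have intL: "integrable (measure_pmf \<mu>) (\<lambda>x. real (level x))"
  proof (rule Bochner_Integration.integrable_bound)
    show "integrable (measure_pmf \<mu>) (\<lambda>x. real_of_int x - bottom)" using intX by simp
    show "AE x in measure_pmf \<mu>. norm (real (level x)) \<le> norm (real_of_int x - bottom)"
      unfolding AE_measure_pmf_iff
    proof
      fix x assume "x \<in> supp"
      from level_le[OF this] have "real_of_int (int (level x)) \<le> real_of_int (x - bottom)"
        by (simp only: of_int_le_iff)
      then show "norm (real (level x)) \<le> norm (real_of_int x - bottom)" by simp
    qed
  qed simp
  have nn: "(\<integral>\<^sup>+ x. ennreal (psi \<mu> x - x) \<partial>measure_pmf \<mu>) = ennreal (measure_pmf.expectation \<mu> (\<lambda>x. real (level x)))"
    unfolding nn_integral_overshoot by (rule nn_integral_eq_integral[OF intL]) simp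
  have intO: "integrable (measure_pmf \<mu>) (\<lambda>x. psi \<mu> x - x)"
    and EO: "measure_pmf.expectation \<mu> (\<lambda>x. psi \<mu> x - x) = measure_pmf.expectation \<mu> (\<lambda>x. real (level x))"
    using nn_integral_eq_integrable[THEN iffD1, OF _ _ _ nn] le_psi by (auto simp: AE_measure_pmf_iff)
  have intPsi: "integrable (measure_pmf \<mu>) (psi \<mu>)"
    and EPsi: "measure_pmf.expectation \<mu> (psi \<mu>) = measure_pmf.expectation \<mu> (\<lambda>x. real (level x))"
    using Bochner_Integration.integrable_add[OF intO intX] Bochner_Integration.integral_add[OF intO intX] EO EX
    by simp_all
  have int: "integrable (measure_pmf \<mu>) (\<lambda>x. psi \<mu> x - level x)"
    and 0: "measure_pmf.expectation \<mu> (\<lambda>x. psi \<mu> x - level x) = 0"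
    using intPsi intL EPsi by simp_all
  have "AE x in measure_pmf \<mu>. psi \<mu> x - level x = 0"
    using integral_nonneg_eq_0_iff_AE[OF int] 0 level_le_psi by (simp add: AE_measure_pmf_iff)
  then show ?thesis using x by (simp add: AE_measure_pmf_iff)
qed

text \<open>The hypothesis \<open>x < level x\<close> says that the overshoot at \<open>x\<close> is positive, that is, that \<open>\<mu>\<close> has mass
  above \<open>x\<close>. When the support is bounded this is what keeps the maximum of the unstopped walk among the levels.\<close>

lemma next_level:
  assumes x: "x \<in> supp" and "x < int (level x)"
  shows "\<exists>y \<in> supp. level y = Suc (level x)"
proof -
  have "real_of_int x < real (level x)" using assms(2) by linarith
  then have "measure_pmf.prob \<mu> {x + 1..} \<noteq> 0"
    using psi_overshoot[OF x] x by (auto simp: psi_eq_level[OF x] set_pmf_iff)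
  then obtain u where u: "u \<in> supp" "x < u"
    by (force simp: measure_pmf_zero_iff)
  define y where "y = Min ({x<..u} \<inter> supp)"
  have y: "y \<in> {x<..u} \<inter> supp" unfolding y_def using u by (intro Min_in) auto
  have y_le: "y \<le> z" if "z \<in> supp" "x < z" for z
  proof (cases "z \<le> u")
    case True then show ?thesis unfolding y_def using that by (intro Min_le) auto
  next
    case False
    then show ?thesis using y by auto
  qed
  have "z < y \<longleftrightarrow> z \<le> x" if "z \<in> supp" for z
    using y y_le[OF that] by (cases "x < z") auto
  then have "{z \<in> supp. z < y} = {z \<in> supp. z \<le> x}" by blast
  also have "\<dots> = insert x {z \<in> supp. z < x}" using x by auto
  finally have "{z \<in> supp. z < y} = insert x {z \<in> supp. z < x}" .
  then have "level y = Suc (level x)" unfolding level_def using finite_below[of x] by simp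
  then show ?thesis using y by blast
qed

text \<open>Splitting the total mass at \<open>x\<close> gives the mass at \<open>x\<close> in terms of the finitely many support points below,
  so strong induction on the level determines the distribution.\<close>

lemma pmf_eqI_overshoot:
  assumes supp: "set_pmf \<nu> \<subseteq> supp"
    and tail: "\<And>x. x \<in> supp \<Longrightarrow> (psi \<mu> x - real_of_int x) * pmf \<nu> x = measure_pmf.prob \<nu> {x + 1..}"
  shows "\<nu> = \<mu>"
proof -
  \<comment> \<open>Stated for an arbitrary distribution, as it is applied to both \<open>\<nu>\<close> and \<open>\<mu>\<close>.\<close>
  have split: "(\<Sum>y \<in> {y \<in> supp. y < x}. pmf \<kappa> y) + (1 + (psi \<mu> x - x)) * pmf \<kappa> x = 1"
    if "set_pmf \<kappa> \<subseteq> supp" "(psi \<mu> x - real_of_int x) * pmf \<kappa> x = measure_pmf.prob \<kappa> {x + 1..}" for \<kappa> x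
  proof -
    have "1 = measure_pmf.prob \<kappa> UNIV" by simp
    also have "(UNIV :: int set) = {..<x} \<union> ({x} \<union> {x + 1..})" by auto
    also have "measure_pmf.prob \<kappa> \<dots> = measure_pmf.prob \<kappa> {..<x} + (pmf \<kappa> x + measure_pmf.prob \<kappa> {x + 1..})"
      by (subst measure_pmf.finite_measure_Union; (subst measure_pmf.finite_measure_Union)?) (auto simp: pmf.rep_eq)
    also have "measure_pmf.prob \<kappa> {..<x} = measure_pmf.prob \<kappa> {y \<in> supp. y < x}"
      using that(1) by (intro measure_pmf.finite_measure_eq_AE) (auto simp: AE_measure_pmf_iff)
    also have "\<dots> = (\<Sum>y \<in> {y \<in> supp. y < x}. pmf \<kappa> y)"
      by (rule measure_measure_pmf_finite[OF finite_below])
    finally show ?thesis using that(2) by (simp add: algebra_simps)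
  qed
  have "pmf \<nu> x = pmf \<mu> x" if "x \<in> supp" for x
    using that
  proof (induction "level x" arbitrary: x rule: less_induct)
    case less
    have "(\<Sum>y \<in> {y \<in> supp. y < x}. pmf \<nu> y) = (\<Sum>y \<in> {y \<in> supp. y < x}. pmf \<mu> y)"
      by (intro sum.cong refl less.hyps) (auto intro: level_less)
    then have "(1 + (psi \<mu> x - x)) * pmf \<nu> x = (1 + (psi \<mu> x - x)) * pmf \<mu> x"
      using split[OF supp tail[OF less.prems]] split[OF order_refl psi_overshoot[OF less.prems]] by linarith
    then show ?case using le_psi[OF less.prems] by simp
  qed
  then show ?thesis
    using supp by (intro pmf_eqI) (metis pmf_eq_0_set_pmf subsetD)
qed

end

section \<open>Paths of the walk and its maximum\<close>

text \<open>The steps take these values almost surely only, so the arguments on single paths assume it explicitly.\<close>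

definition unit_steps :: "(nat \<Rightarrow> 'a \<Rightarrow> int) \<Rightarrow> 'a \<Rightarrow> bool" where
  "unit_steps \<xi> \<omega> \<longleftrightarrow> (\<forall>t \<ge> 1. \<xi> t \<omega> \<in> {-1, 0, 1})"

lemma walk_max_0 [simp]: "walk_max \<xi> 0 \<omega> = 0"
  by (simp add: walk_max_def)

lemma walk_max_Suc [simp]:
  "walk_max \<xi> (Suc t) \<omega> = max (walk_max \<xi> t \<omega>) (walk \<xi> (Suc t) \<omega>)"
  unfolding walk_max_def by (simp add: atLeast0_atMost_Suc max.commute)

lemma walk_le_walk_max: "walk \<xi> t \<omega> \<le> walk_max \<xi> t \<omega>"
  by (cases t) auto

lemma walk_max_nonneg: "0 \<le> walk_max \<xi> t \<omega>"
  by (induction t) auto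

lemma abs_walk_le: "unit_steps \<xi> \<omega> \<Longrightarrow> \<bar>walk \<xi> t \<omega>\<bar> \<le> int t"
proof (induction t)
  case (Suc t)
  then have "\<xi> (Suc t) \<omega> \<in> {-1, 0, 1}" by (auto simp: unit_steps_def)
  then show ?case using Suc by auto
qed simp

text \<open>The potential \<open>(if m > i then 1 else if m = i then z - i else 0)\<close> of maximum \<open>m\<close> and position \<open>z\<close> changes only
  while \<open>m = i\<close>, and then exactly by the step \<open>e\<close>: a step from \<open>(i, i)\<close> to \<open>(i + 1, i + 1)\<close> replaces \<open>0\<close> by \<open>1\<close>.\<close>

lemma azema_yor_step:
  fixes m z i e :: int
  assumes "z \<le> m" "e \<in> {-1, 0, 1}"
  shows "(if m > i then 1 else if m = i then z - i else 0) + (if m = i then e else 0) =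
    (if max m (z + e) > i then 1 else if max m (z + e) = i then z + e - i else 0)"
proof (cases "z + e \<le> m")
  case True
  then show ?thesis by (simp add: max_absorb1)
next
  case False
  then have "e = 1" "z = m" using assms by auto
  then show ?thesis by simp
qed

text \<open>The discrete Azema--Yor martingale for the indicator of \<open>{i<..}\<close>, as a telescoped sum of the steps it bets on.\<close>

lemma azema_yor_path:
  assumes "unit_steps \<xi> \<omega>" "0 \<le> i"
  shows "(\<Sum>s<t. if walk_max \<xi> s \<omega> = i then \<xi> (Suc s) \<omega> else 0) =
    (if walk_max \<xi> t \<omega> > i then 1 else if walk_max \<xi> t \<omega> = i then walk \<xi> t \<omega> - i else 0)"
proof (induction t)
  case (Suc t)
  have "\<xi> (Suc t) \<omega> \<in> {-1, 0, 1}" using assms by (auto simp: unit_steps_def)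
  from azema_yor_step[OF walk_le_walk_max this] show ?case
    unfolding sum.lessThan_Suc Suc walk_max_Suc walk.simps .
qed (use assms in auto)

text \<open>The two congruence rules compare paths over different sample spaces. This allows the walk to be rewritten as a
  function of the finite tuple of its first steps, where independence applies.\<close>

lemma walk_cong:
  "(\<And>j. j \<in> {1..t} \<Longrightarrow> \<xi> j \<omega> = \<xi>' j \<omega>') \<Longrightarrow> walk \<xi> t \<omega> = walk \<xi>' t \<omega>'"
  by (induction t) auto

lemma walk_max_cong:
  "(\<And>j. j \<in> {1..t} \<Longrightarrow> \<xi> j \<omega> = \<xi>' j \<omega>') \<Longrightarrow> walk_max \<xi> t \<omega> = walk_max \<xi>' t \<omega>'"
  unfolding walk_max_def by (intro arg_cong[of _ _ Max] image_cong refl walk_cong) auto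

lemma measurable_count_space_binop:
  fixes f :: "'a \<Rightarrow> 'b :: countable"
  assumes "f \<in> measurable N (count_space UNIV)" "g \<in> measurable N (count_space UNIV)"
  shows "(\<lambda>x. h (f x) (g x)) \<in> measurable N (count_space UNIV)"
  by (rule measurable_compose_countable[OF _ assms(1)]) (rule measurable_compose[OF assms(2)], simp)

lemma measurable_walk:
  assumes "\<And>j. j \<in> {1..t} \<Longrightarrow> \<xi> j \<in> measurable N (count_space UNIV)"
  shows "walk \<xi> t \<in> measurable N (count_space UNIV)"
  using assms
proof (induction t)
  case 0
  show ?case by (simp add: walk.simps(1)[abs_def])
next
  case (Suc t)
  have "walk \<xi> t \<in> measurable N (count_space UNIV)" "\<xi> (Suc t) \<in> measurable N (count_space UNIV)"
    using Suc by simp_all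
  from measurable_count_space_binop[OF this, where h = "(+)"] show ?case
    unfolding walk.simps(2)[abs_def] .
qed

lemma measurable_walk_max:
  assumes "\<And>j. j \<in> {1..t} \<Longrightarrow> \<xi> j \<in> measurable N (count_space UNIV)"
  shows "walk_max \<xi> t \<in> measurable N (count_space UNIV)"
  using assms
proof (induction t)
  case 0
  show ?case by (simp add: walk_max_0[abs_def])
next
  case (Suc t)
  have "walk_max \<xi> t \<in> measurable N (count_space UNIV)" using Suc by simp
  from measurable_count_space_binop[OF this measurable_walk[OF Suc.prems], where h = max]
  show ?case unfolding walk_max_Suc[abs_def] .
qed

section \<open>The stopping time on a single path\<close>

context admissible_target
begin

text \<open>The stopping condition in integers; off the support the value \<open>- 1\<close> of \<open>psi\<close> never equals the maximum.\<close>

definition stops_at :: "(nat \<Rightarrow> 'a \<Rightarrow> int) \<Rightarrow> 'a \<Rightarrow> nat \<Rightarrow> bool" where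
  "stops_at \<xi> \<omega> t \<longleftrightarrow> walk \<xi> t \<omega> \<in> supp \<and> walk_max \<xi> t \<omega> = int (level (walk \<xi> t \<omega>))"

lemma stops_at_iff: "real_of_int (walk_max \<xi> t \<omega>) = psi \<mu> (walk \<xi> t \<omega>) \<longleftrightarrow> stops_at \<xi> \<omega> t"
proof (cases "walk \<xi> t \<omega> \<in> supp")
  case True
  then show ?thesis by (simp add: stops_at_def psi_eq_level) linarith
next
  case False
  then show ?thesis using walk_max_nonneg[of \<xi> t \<omega>] by (simp add: stops_at_def psi_def)
qed

lemma T_mu_eq: "T_mu \<xi> \<mu> \<omega> = (if \<exists>t. stops_at \<xi> \<omega> t then enat (LEAST t. stops_at \<xi> \<omega> t) else \<infinity>)"
proof (cases "\<exists>t. stops_at \<xi> \<omega> t")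
  case True
  then have "stops_at \<xi> \<omega> (LEAST t. stops_at \<xi> \<omega> t)" by (rule LeastI_ex)
  then have "Inf {enat t |t. stops_at \<xi> \<omega> t} = enat (LEAST t. stops_at \<xi> \<omega> t)"
    by (intro Inf_eqI) (auto simp: Least_le)
  then show ?thesis unfolding T_mu_def stops_at_iff using True by simp
next
  case False
  then show ?thesis unfolding T_mu_def stops_at_iff by (simp add: top_enat_def)
qed

lemma less_T_mu_iff: "enat s < T_mu \<xi> \<mu> \<omega> \<longleftrightarrow> (\<forall>t \<le> s. \<not> stops_at \<xi> \<omega> t)"
proof (cases "\<exists>t. stops_at \<xi> \<omega> t")
  case True
  then have "stops_at \<xi> \<omega> (LEAST t. stops_at \<xi> \<omega> t)" by (rule LeastI_ex)
  then have "s < (LEAST t. stops_at \<xi> \<omega> t) \<longleftrightarrow> (\<forall>t \<le> s. \<not> stops_at \<xi> \<omega> t)"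
    using not_less_Least[of _ "stops_at \<xi> \<omega>"] by (meson le_less_trans not_le)
  with True show ?thesis unfolding T_mu_eq by simp
next
  case False
  then show ?thesis unfolding T_mu_eq by auto
qed

lemma stops_at_T_mu:
  assumes "T_mu \<xi> \<mu> \<omega> = enat t"
  shows "stops_at \<xi> \<omega> t"
proof -
  have ex: "\<exists>t. stops_at \<xi> \<omega> t"
    using assms unfolding T_mu_eq by (metis enat.distinct(2))
  then have "t = (LEAST t. stops_at \<xi> \<omega> t)" using assms unfolding T_mu_eq by simp
  with LeastI_ex[OF ex] show ?thesis by simp
qed

text \<open>When the maximum rises from \<open>level x\<close> to \<open>level x + 1\<close>, the walk was above \<open>x\<close>, so \<open>x\<close> lies below its level
  and the next level is attained by a support point; it does not exceed its level, where the walk now is.\<close>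

lemma ex_barrier:
  assumes "unit_steps \<xi> \<omega>" "\<And>t. t < s \<Longrightarrow> \<not> stops_at \<xi> \<omega> t"
  shows "\<exists>x \<in> supp. int (level x) = walk_max \<xi> s \<omega> \<and> x \<le> walk \<xi> s \<omega>"
  using assms(2)
proof (induction s)
  case 0
  show ?case using bottom_in_supp level_le[OF bottom_in_supp] le_psi[OF bottom_in_supp]
    by (intro bexI[of _ bottom]) (auto simp: psi_eq_level level_bottom)
next
  case (Suc s)
  then obtain x where x: "x \<in> supp" "int (level x) = walk_max \<xi> s \<omega>" "x \<le> walk \<xi> s \<omega>"
    by auto
  have less: "x < walk \<xi> s \<omega>"
    using x Suc.prems[of s] by (auto simp: stops_at_def order_less_le)
  have step: "\<xi> (Suc s) \<omega> \<in> {-1, 0, 1}" using assms(1) by (auto simp: unit_steps_def)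
  show ?case
  proof (cases "walk \<xi> (Suc s) \<omega> \<le> walk_max \<xi> s \<omega>")
    case True
    then show ?thesis using x less step by (intro bexI[of _ x]) auto
  next
    case False
    then have new: "walk \<xi> (Suc s) \<omega> = int (Suc (level x))" "x < int (level x)"
      using x less step walk_le_walk_max[of \<xi> s \<omega>] by auto
    obtain y where y: "y \<in> supp" "level y = Suc (level x)" using next_level[OF x(1) new(2)] by blast
    have "y \<le> int (level y)" using le_psi[OF y(1)] unfolding psi_eq_level[OF y(1)] by linarith
    then show ?thesis using y new x False by (intro bexI[of _ y]) auto
  qed
qed

text \<open>Going down, the walk leaves its maximum unchanged and meets the support point at the level of the maximum,
  which is at most \<open>- bottom\<close> below.\<close>

lemma down_run_stops:
  assumes path: "unit_steps \<xi> \<omega>" and before: "enat s < T_mu \<xi> \<mu> \<omega>"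
    and down: "\<And>j. j \<in> {s + 1..s + nat (- bottom)} \<Longrightarrow> \<xi> j \<omega> = -1"
  shows "\<not> enat (s + nat (- bottom)) < T_mu \<xi> \<mu> \<omega>"
proof -
  obtain x where x: "x \<in> supp" "int (level x) = walk_max \<xi> s \<omega>" "x \<le> walk \<xi> s \<omega>"
    using ex_barrier[OF path, of s] before by (auto simp: less_T_mu_iff)
  have run: "j \<le> nat (- bottom) \<Longrightarrow>
      walk \<xi> (s + j) \<omega> = walk \<xi> s \<omega> - int j \<and> walk_max \<xi> (s + j) \<omega> = walk_max \<xi> s \<omega>" for j
  proof (induction j)
    case (Suc j)
    have "\<xi> (Suc (s + j)) \<omega> = -1" using Suc.prems by (intro down) auto
    then show ?case using Suc walk_le_walk_max[of \<xi> s \<omega>] by auto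
  qed simp
  define k where "k = nat (walk \<xi> s \<omega> - x)"
  have k: "k \<le> nat (- bottom)"
    using level_le[OF x(1)] x(2) walk_le_walk_max[of \<xi> s \<omega>] unfolding k_def by linarith
  have "stops_at \<xi> \<omega> (s + k)" using run[OF k] x unfolding stops_at_def k_def by simp
  moreover have "s + k \<le> s + nat (- bottom)" using k by simp
  ultimately show ?thesis unfolding less_T_mu_iff by blast
qed

lemma less_T_mu_cong:
  assumes "\<And>j. j \<in> {1..s} \<Longrightarrow> \<xi> j \<omega> = \<xi>' j \<omega>'"
  shows "enat s < T_mu \<xi> \<mu> \<omega> \<longleftrightarrow> enat s < T_mu \<xi>' \<mu> \<omega>'"
proof -
  have "stops_at \<xi> \<omega> t \<longleftrightarrow> stops_at \<xi>' \<omega>' t" if "t \<le> s" for t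
  proof -
    have "\<xi> j \<omega> = \<xi>' j \<omega>'" if "j \<in> {1..t}" for j using assms[of j] that \<open>t \<le> s\<close> by simp
    note walk_cong[of t \<xi> \<omega> \<xi>' \<omega>', OF this] walk_max_cong[of t \<xi> \<omega> \<xi>' \<omega>', OF this]
    then show ?thesis by (simp add: stops_at_def)
  qed
  then show ?thesis by (simp add: less_T_mu_iff)
qed

lemma measurable_stops_at:
  assumes "\<And>j. j \<in> {1..t} \<Longrightarrow> \<xi> j \<in> measurable N (count_space UNIV)"
  shows "Measurable.pred N (\<lambda>\<omega>. stops_at \<xi> \<omega> t)"
  unfolding stops_at_def
  by (rule measurable_count_space_binop[where h = "\<lambda>z m. z \<in> supp \<and> m = int (level z)",
        OF measurable_walk[OF assms] measurable_walk_max[OF assms]])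

lemma measurable_less_T_mu:
  assumes "\<And>j. j \<in> {1..s} \<Longrightarrow> \<xi> j \<in> measurable N (count_space UNIV)"
  shows "Measurable.pred N (\<lambda>\<omega>. enat s < T_mu \<xi> \<mu> \<omega>)"
proof -
  have stops: "Measurable.pred N (\<lambda>\<omega>. stops_at \<xi> \<omega> t)" if "t \<le> s" for t
    by (rule measurable_stops_at, rule assms) (use that in simp)
  have "Measurable.pred N (\<lambda>\<omega>. \<forall>t \<in> {..s}. \<not> stops_at \<xi> \<omega> t)"
    by (rule pred_intros_finite(3)[OF finite_atMost], rule pred_intros_logic(2), rule stops) simp
  then show ?thesis unfolding less_T_mu_iff by (simp only: Ball_def atMost_iff)
qed

lemma measurable_T_mu:
  assumes "\<And>j. j \<ge> 1 \<Longrightarrow> \<xi> j \<in> measurable N (count_space UNIV)"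
  shows "T_mu \<xi> \<mu> \<in> measurable N (count_space UNIV)"
proof -
  have [measurable]: "Measurable.pred N (\<lambda>\<omega>. stops_at \<xi> \<omega> t)" for t
    using assms by (intro measurable_stops_at) auto
  have "(\<lambda>\<omega>. if \<exists>t. stops_at \<xi> \<omega> t then enat (LEAST t. stops_at \<xi> \<omega> t) else \<infinity>)
      \<in> measurable N (count_space UNIV)"
    by measurable
  then show ?thesis by (simp add: T_mu_eq[abs_def])
qed

end

section \<open>Independence of past and future steps\<close>

context random_walk_steps
begin

lemma measurable_step: "t \<ge> 1 \<Longrightarrow> \<xi> t \<in> measurable M (count_space UNIV)"
  using indep_steps by (auto simp: indep_vars_def)

lemma sets_step_eq: "t \<ge> 1 \<Longrightarrow> {\<omega> \<in> space M. \<xi> t \<omega> = k} \<in> events"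
  using measurable_sets[OF measurable_step, of t "{k}"] by (simp add: vimage_def Int_def conj_commute)

lemma AE_unit_steps: "AE \<omega> in M. unit_steps \<xi> \<omega>"
proof -
  have "AE \<omega> in M. \<xi> t \<omega> \<in> {-1, 0, 1}" if t: "t \<ge> 1" for t
  proof -
    let ?E = "\<lambda>k. {\<omega> \<in> space M. \<xi> t \<omega> = k}"
    have "prob (?E (-1) \<union> (?E 0 \<union> ?E 1)) = prob (?E (-1)) + (prob (?E 0) + prob (?E 1))"
      using sets_step_eq[OF t]
      by (subst finite_measure_Union; (subst finite_measure_Union)?) (auto intro!: sets.Un)
    also have "\<dots> = 1" using prob_up[OF t] prob_down[OF t] prob_stay[OF t] sum_one by simp
    finally have "AE \<omega> in M. \<omega> \<in> ?E (-1) \<union> (?E 0 \<union> ?E 1)"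
      using sets_step_eq[OF t] by (subst (asm) prob_eq_1) auto
    then show ?thesis by (rule eventually_mono) auto
  qed
  then have "AE \<omega> in M. \<forall>t. t \<ge> 1 \<longrightarrow> \<xi> t \<omega> \<in> {-1, 0, 1}"
    by (subst AE_all_countable) (auto intro: AE_impI)
  then show ?thesis by (simp add: unit_steps_def)
qed

lemma integrable_step: "t \<ge> 1 \<Longrightarrow> integrable M (\<lambda>\<omega>. real_of_int (\<xi> t \<omega>))"
  and expectation_step: "t \<ge> 1 \<Longrightarrow> expectation (\<lambda>\<omega>. real_of_int (\<xi> t \<omega>)) = p - q"
proof -
  assume t: "t \<ge> 1"
  let ?f = "\<lambda>\<omega>. indicat_real {\<omega> \<in> space M. \<xi> t \<omega> = 1} \<omega> - indicat_real {\<omega> \<in> space M. \<xi> t \<omega> = -1} \<omega>"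
  have meas: "(\<lambda>\<omega>. real_of_int (\<xi> t \<omega>)) \<in> borel_measurable M"
    using measurable_step[OF t] by measurable
  have ind: "integrable M (indicat_real {\<omega> \<in> space M. \<xi> t \<omega> = k})" for k
    by (intro integrable_real_indicator sets_step_eq[OF t]) (simp add: emeasure_eq_measure)
  then have int: "integrable M ?f" by (intro Bochner_Integration.integrable_diff)
  have eq: "AE \<omega> in M. ?f \<omega> = real_of_int (\<xi> t \<omega>)"
    using AE_unit_steps AE_space
  proof eventually_elim
    case (elim \<omega>)
    then have "\<xi> t \<omega> \<in> {-1, 0, 1}" using t by (auto simp: unit_steps_def)
    then show ?case using elim(2) by (auto simp: indicator_def)
  qed
  show "integrable M (\<lambda>\<omega>. real_of_int (\<xi> t \<omega>))"
    using integrable_cong_AE_imp[OF int meas] eq by simp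
  have "expectation (\<lambda>\<omega>. real_of_int (\<xi> t \<omega>)) = expectation ?f"
    using eq by (intro integral_cong_AE meas borel_measurable_integrable[OF int]) auto
  also have "\<dots> = p - q"
    using Bochner_Integration.integral_diff[OF ind ind, of 1 "-1"] sets_step_eq[OF t] prob_up[OF t] prob_down[OF t]
    by simp
  finally show "expectation (\<lambda>\<omega>. real_of_int (\<xi> t \<omega>)) = p - q" .
qed

text \<open>Only the steps from index \<open>1\<close> on are independent, so past and future are restrictions to index intervals.\<close>

lemma indep_past_future:
  assumes "f \<in> measurable (Pi\<^sub>M {1..s} (\<lambda>_. count_space UNIV)) N1"
    and "g \<in> measurable (Pi\<^sub>M {s + 1..s + n} (\<lambda>_. count_space UNIV)) N2"
  shows "indep_var N1 (\<lambda>\<omega>. f (restrict (\<lambda>i. \<xi> i \<omega>) {1..s})) N2 (\<lambda>\<omega>. g (restrict (\<lambda>i. \<xi> i \<omega>) {s + 1..s + n}))"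
proof -
  have "indep_var (Pi\<^sub>M {1..s} (\<lambda>_. count_space UNIV)) (\<lambda>\<omega>. restrict (\<lambda>i. \<xi> i \<omega>) {1..s})
      (Pi\<^sub>M {s + 1..s + n} (\<lambda>_. count_space UNIV)) (\<lambda>\<omega>. restrict (\<lambda>i. \<xi> i \<omega>) {s + 1..s + n})"
    by (rule indep_var_restrict[OF indep_steps]) auto
  from indep_var_compose[OF this assms] show ?thesis by (simp only: comp_def)
qed

lemma prob_down_run: "prob {\<omega> \<in> space M. \<forall>j \<in> {s + 1..s + n}. \<xi> j \<omega> = -1} = q ^ n"
proof (cases "n = 0")
  case True
  then show ?thesis by (simp add: prob_space)
next
  case False
  have "{\<omega> \<in> space M. \<forall>j \<in> {s + 1..s + n}. \<xi> j \<omega> = -1} = (\<Inter>j \<in> {s + 1..s + n}. \<xi> j -` {-1} \<inter> space M)"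
    using False by auto
  also have "prob \<dots> = (\<Prod>j \<in> {s + 1..s + n}. prob (\<xi> j -` {-1} \<inter> space M))"
    using False by (intro indep_varsD[OF indep_steps]) auto
  also have "\<dots> = (\<Prod>j \<in> {s + 1..s + n}. q)"
    using prob_down by (intro prod.cong refl) (auto simp: vimage_def Int_def conj_commute)
  finally show ?thesis by simp
qed

end

section \<open>Integrability of the stopping time\<close>

locale symmetric_walk_embedding = random_walk_steps M \<xi> p q r + admissible_target \<mu>
  for M :: "'a measure" and \<xi> p q r \<mu> +
  assumes symmetric: "p = q"
begin

abbreviation T :: "'a \<Rightarrow> enat" where "T \<equiv> T_mu \<xi> \<mu>"

lemma measurable_T [measurable]: "T \<in> measurable M (count_space UNIV)"
  using measurable_step by (rule measurable_T_mu)

lemma measurable_walk_M [measurable]: "walk \<xi> t \<in> measurable M (count_space UNIV)"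
  using measurable_step by (intro measurable_walk) auto

lemma measurable_coordinate:
  "j \<in> I \<Longrightarrow> (\<lambda>f. f j) \<in> measurable (Pi\<^sub>M I (\<lambda>_. count_space UNIV)) (count_space UNIV)"
  by (rule measurable_component_singleton)

lemma less_T_restrict:
  "enat s < T \<omega> \<longleftrightarrow> enat s < T_mu (\<lambda>j f. f j) \<mu> (restrict (\<lambda>j. \<xi> j \<omega>) {1..s})"
  by (rule less_T_mu_cong) simp

lemma walk_max_restrict:
  "walk_max \<xi> s \<omega> = walk_max (\<lambda>j f. f j) s (restrict (\<lambda>j. \<xi> j \<omega>) {1..s})"
  by (rule walk_max_cong) simp

text \<open>Being unstopped at time \<open>s\<close> depends on the first \<open>s\<close> steps, and is independent of a subsequent run of
  \<open>- bottom\<close> down-steps, which would stop the walk.\<close>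

lemma prob_less_T_contraction:
  "prob {\<omega> \<in> space M. enat (s + nat (- bottom)) < T \<omega>} \<le>
    (1 - q ^ nat (- bottom)) * prob {\<omega> \<in> space M. enat s < T \<omega>}"
proof -
  define n where "n = nat (- bottom)"
  define A where "A = {\<omega> \<in> space M. enat s < T \<omega>}"
  define B where "B = {\<omega> \<in> space M. \<forall>j \<in> {s + 1..s + n}. \<xi> j \<omega> = -1}"
  have [measurable]: "A \<in> events" unfolding A_def by measurable
  have [measurable]: "B \<in> events"
    using sets_step_eq unfolding B_def by (intro sets.sets_Collect_finite_All) auto
  let ?f = "\<lambda>f. enat s < T_mu (\<lambda>j f. f j) \<mu> f" and ?g = "\<lambda>f. \<forall>j \<in> {s + 1..s + n}. f j = (-1 :: int)"
  have f: "?f \<in> measurable (Pi\<^sub>M {1..s} (\<lambda>_. count_space UNIV)) (count_space UNIV)"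
    by (intro measurable_less_T_mu measurable_coordinate)
  have g: "?g \<in> measurable (Pi\<^sub>M {s + 1..s + n} (\<lambda>_. count_space UNIV)) (count_space UNIV)"
    by (intro pred_intros_finite pred_eq_const1[where N = "count_space UNIV"] measurable_coordinate) auto
  have "prob (A \<inter> (space M - B)) = prob A * prob (space M - B)"
    using indep_varD[OF indep_past_future[OF f g], of "{True}" "{False}"]
    unfolding less_T_restrict[symmetric]
    by (simp add: A_def B_def vimage_def Int_def set_diff_eq conj_ac cong: conj_cong)
  also have "prob (space M - B) = 1 - q ^ n"
    using prob_down_run[of s n, folded B_def] by (simp add: prob_compl)
  finally have eq: "prob (A \<inter> (space M - B)) = (1 - q ^ n) * prob A" by simp
  have "prob {\<omega> \<in> space M. enat (s + n) < T \<omega>} \<le> prob (A \<inter> (space M - B))"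
  proof (rule finite_measure_mono_AE)
    show "AE \<omega> in M. \<omega> \<in> {\<omega> \<in> space M. enat (s + n) < T \<omega>} \<longrightarrow> \<omega> \<in> A \<inter> (space M - B)"
      using AE_unit_steps
    proof eventually_elim
      case (elim \<omega>)
      show ?case
      proof
        assume *: "\<omega> \<in> {\<omega> \<in> space M. enat (s + n) < T \<omega>}"
        have less: "enat s < T \<omega>" using * by (auto intro: le_less_trans[of _ "enat (s + n)"])
        have "\<omega> \<notin> B" using down_run_stops[OF elim less] * unfolding B_def n_def by blast
        then show "\<omega> \<in> A \<inter> (space M - B)" using * less by (simp add: A_def)
      qed
    qed
  qed measurable
  then show ?thesis unfolding eq unfolding A_def n_def .
qed

text \<open>Summing the contraction over \<open>s < m\<close> bounds the partial sums by themselves times \<open>1 - q ^ n\<close> plus the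
  \<open>n\<close> terms lost in the shift, where \<open>n = nat (- bottom)\<close>.\<close>

lemma summable_prob_less_T: "summable (\<lambda>s. prob {\<omega> \<in> space M. enat s < T \<omega>})"
proof -
  define a where "a s = prob {\<omega> \<in> space M. enat s < T \<omega>}" for s
  define n where "n = nat (- bottom)"
  have pos: "0 < q ^ n" using q_pos by simp
  have split: "(\<Sum>s<n + m. a s) = (\<Sum>s<n. a s) + (\<Sum>s<m. a (s + n))" for m
    by (induction m) (simp_all add: add.commute)
  have "(\<Sum>s<m. a s) \<le> n / q ^ n" for m
  proof -
    have "(\<Sum>s<m. a s) \<le> (\<Sum>s<n + m. a s)" by (rule sum_mono2) (auto simp: a_def)
    also have "\<dots> \<le> n + (\<Sum>s<m. (1 - q ^ n) * a s)"
      unfolding split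
    proof (rule add_mono)
      show "(\<Sum>s<n. a s) \<le> n" using sum_bounded_above[of "{..<n}" a 1] by (simp add: a_def)
      show "(\<Sum>s<m. a (s + n)) \<le> (\<Sum>s<m. (1 - q ^ n) * a s)"
        unfolding a_def n_def by (intro sum_mono prob_less_T_contraction)
    qed
    also have "\<dots> = n + (1 - q ^ n) * (\<Sum>s<m. a s)" by (simp add: sum_distrib_left)
    finally show ?thesis using pos by (simp add: field_simps)
  qed
  then have "summable a" by (intro summableI_nonneg_bounded[of _ "n / q ^ n"]) (auto simp: a_def)
  then show ?thesis by (simp add: a_def[abs_def])
qed

lemma nn_integral_T_finite: "(\<integral>\<^sup>+ \<omega>. ennreal_of_enat (T \<omega>) \<partial>M) < \<infinity>"
proof -
  have "(\<integral>\<^sup>+ \<omega>. ennreal_of_enat (T \<omega>) \<partial>M) = (\<Sum>s. ennreal (prob {\<omega> \<in> space M. enat s < T \<omega>}))"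
    by (simp add: nn_integral_enat_function[OF measurable_T] emeasure_eq_measure)
  also have "\<dots> = ennreal (\<Sum>s. prob {\<omega> \<in> space M. enat s < T \<omega>})"
    by (intro suminf_ennreal2 summable_prob_less_T) simp
  finally show ?thesis by simp
qed

lemma AE_T_finite: "AE \<omega> in M. T \<omega> < \<infinity>"
proof -
  have "(\<lambda>\<omega>. ennreal_of_enat (T \<omega>)) \<in> borel_measurable M" by measurable
  then have "AE \<omega> in M. ennreal_of_enat (T \<omega>) \<noteq> \<infinity>"
    using nn_integral_T_finite by (intro nn_integral_PInf_AE) auto
  then show ?thesis by (rule eventually_mono) (metis enat_ord_simps(4) ennreal_of_enat_infty infinity_ennreal_def)
qed

text \<open>Real-valued version of the stopping time, for Bochner integrals.\<close>

definition duration :: "'a \<Rightarrow> real" where "duration \<omega> = real (the_enat (T \<omega>))"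

definition terminal :: "'a \<Rightarrow> int" where "terminal \<omega> = walk \<xi> (the_enat (T \<omega>)) \<omega>"

lemma integrable_duration: "integrable M duration"
proof (rule integrableI_nonneg)
  show "duration \<in> borel_measurable M" unfolding duration_def[abs_def] by measurable
  have "(\<integral>\<^sup>+ \<omega>. ennreal (duration \<omega>) \<partial>M) \<le> (\<integral>\<^sup>+ \<omega>. ennreal_of_enat (T \<omega>) \<partial>M)"
  proof (rule nn_integral_mono)
    fix \<omega>
    show "ennreal (duration \<omega>) \<le> ennreal_of_enat (T \<omega>)"
      by (cases "T \<omega>") (auto simp: duration_def ennreal_of_nat_eq_real_of_nat)
  qed
  then show "(\<integral>\<^sup>+ \<omega>. ennreal (duration \<omega>) \<partial>M) < \<infinity>"
    using nn_integral_T_finite by (rule le_less_trans)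
qed (simp add: duration_def)

lemma measurable_terminal [measurable]: "terminal \<in> measurable M (count_space UNIV)"
  unfolding terminal_def[abs_def]
  by (rule measurable_compose_countable[where g = "\<lambda>\<omega>. the_enat (T \<omega>)"]) measurable

lemma measurable_stopped [measurable]: "stopped \<xi> T t \<in> measurable M (count_space UNIV)"
  unfolding stopped_def[abs_def]
  by (rule measurable_compose_countable[where g = "\<lambda>\<omega>. the_enat (min (enat t) (T \<omega>))"]) measurable

lemma AE_stopped_le_duration: "AE \<omega> in M. \<bar>real_of_int (stopped \<xi> T t \<omega>)\<bar> \<le> duration \<omega>"
  using AE_unit_steps AE_T_finite
proof eventually_elim
  case (elim \<omega>)
  then obtain k where k: "T \<omega> = enat k" by auto
  have "\<bar>walk \<xi> (min t k) \<omega>\<bar> \<le> int k"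
    using abs_walk_le[OF elim(1), of "min t k"] by linarith
  then have "\<bar>real_of_int (walk \<xi> (min t k) \<omega>)\<bar> \<le> real k" by linarith
  then show ?case by (simp add: stopped_def duration_def k)
qed

text \<open>The stopped walk is dominated by one integrable variable, whose tail expectations vanish by dominated convergence.\<close>

lemma uniformly_integrable_stopped:
  "uniformly_integrable M (\<lambda>t \<omega>. real_of_int (stopped \<xi> T t \<omega>))"
  unfolding uniformly_integrable_def
proof
  show "\<forall>t. (\<lambda>\<omega>. real_of_int (stopped \<xi> T t \<omega>)) \<in> borel_measurable M" by measurable
  let ?Y = "\<lambda>K \<omega>. duration \<omega> * indicator {\<omega>. K \<le> duration \<omega>} \<omega>"
  have [measurable]: "duration \<in> borel_measurable M" using integrable_duration by auto
  have Y_meas: "?Y K \<in> borel_measurable M" for K by measurable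
  have "((\<lambda>K. expectation (?Y K)) \<longlongrightarrow> expectation (\<lambda>_. 0)) at_top"
  proof (rule integral_dominated_convergence_at_top[OF _ Y_meas integrable_duration])
    show "AE \<omega> in M. ((\<lambda>K. ?Y K \<omega>) \<longlongrightarrow> 0) at_top"
    proof (rule AE_I2)
      fix \<omega>
      show "((\<lambda>K. ?Y K \<omega>) \<longlongrightarrow> 0) at_top"
        by (rule tendsto_eventually, rule eventually_mono[OF eventually_gt_at_top[of "duration \<omega>"]]) simp
    qed
    show "\<forall>\<^sub>F K in at_top. AE \<omega> in M. norm (?Y K \<omega>) \<le> duration \<omega>"
      by (intro always_eventually allI AE_I2) (auto simp: indicator_def duration_def)
  qed simp
  then have lim: "((\<lambda>K. ennreal (expectation (?Y K))) \<longlongrightarrow> 0) at_top"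
    using tendsto_ennrealI by fastforce
  have bound: "(SUP t. \<integral>\<^sup>+ \<omega>. ennreal \<bar>real_of_int (stopped \<xi> T t \<omega>)\<bar> *
      indicator {\<omega>. \<bar>real_of_int (stopped \<xi> T t \<omega>)\<bar> \<ge> K} \<omega> \<partial>M) \<le> ennreal (expectation (?Y K))" for K
  proof (rule SUP_least)
    fix t
    have "(\<integral>\<^sup>+ \<omega>. ennreal \<bar>real_of_int (stopped \<xi> T t \<omega>)\<bar> *
        indicator {\<omega>. \<bar>real_of_int (stopped \<xi> T t \<omega>)\<bar> \<ge> K} \<omega> \<partial>M) \<le> (\<integral>\<^sup>+ \<omega>. ennreal (?Y K \<omega>) \<partial>M)"
    proof (rule nn_integral_mono_AE)
      show "AE \<omega> in M. ennreal \<bar>real_of_int (stopped \<xi> T t \<omega>)\<bar> *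
          indicator {\<omega>. \<bar>real_of_int (stopped \<xi> T t \<omega>)\<bar> \<ge> K} \<omega> \<le> ennreal (?Y K \<omega>)"
        using AE_stopped_le_duration[of t]
        by (rule eventually_mono) (auto simp: indicator_def intro!: ennreal_leI)
    qed
    also have "\<dots> = ennreal (expectation (?Y K))"
    proof (rule nn_integral_eq_integral)
      show "integrable M (?Y K)"
        by (rule Bochner_Integration.integrable_bound[OF integrable_duration Y_meas])
           (auto simp: indicator_def)
    qed (simp add: duration_def)
    finally show "(\<integral>\<^sup>+ \<omega>. ennreal \<bar>real_of_int (stopped \<xi> T t \<omega>)\<bar> *
        indicator {\<omega>. \<bar>real_of_int (stopped \<xi> T t \<omega>)\<bar> \<ge> K} \<omega> \<partial>M) \<le> ennreal (expectation (?Y K))" .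
  qed
  show "((\<lambda>K. SUP t. \<integral>\<^sup>+ \<omega>. ennreal \<bar>real_of_int (stopped \<xi> T t \<omega>)\<bar> *
      indicator {\<omega>. \<bar>real_of_int (stopped \<xi> T t \<omega>)\<bar> \<ge> K} \<omega> \<partial>M) \<longlongrightarrow> 0) at_top"
    by (rule tendsto_sandwich[OF _ _ tendsto_const lim]) (auto intro!: always_eventually bound)
qed

section \<open>The law of the stopping place\<close>

lemma terminal_stops: "T \<omega> = enat k \<Longrightarrow> terminal \<omega> \<in> supp \<and> walk_max \<xi> k \<omega> = int (level (terminal \<omega>))"
  using stops_at_T_mu[of \<xi> \<omega> k] by (simp add: stops_at_def terminal_def)

lemma AE_terminal_in_supp: "AE \<omega> in M. terminal \<omega> \<in> supp"
  using AE_T_finite by (rule eventually_mono) (auto simp: terminal_stops)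

text \<open>The increment from time \<open>s\<close> to \<open>s + 1\<close> of the Azema--Yor martingale for \<open>i\<close>, stopped at \<open>T\<close>.\<close>

definition gain :: "int \<Rightarrow> nat \<Rightarrow> 'a \<Rightarrow> real" where
  "gain i s \<omega> = (if enat s < T \<omega> \<and> walk_max \<xi> s \<omega> = i then real_of_int (\<xi> (Suc s) \<omega>) else 0)"

text \<open>The decision to bet depends on the first \<open>s\<close> steps only, so the gain is a product of independent variables, and
  the step has mean \<open>p - q = 0\<close>.\<close>

lemma integrable_gain: "integrable M (gain i s)" and expectation_gain: "expectation (gain i s) = 0"
proof -
  let ?f = "\<lambda>f. if enat s < T_mu (\<lambda>j f. f j) \<mu> f \<and> walk_max (\<lambda>j f. f j) s f = i then 1 else 0 :: real"
  let ?g = "\<lambda>f. real_of_int (f (Suc s))"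
  let ?past = "\<lambda>\<omega>. ?f (restrict (\<lambda>j. \<xi> j \<omega>) {1..s})"
  let ?next = "\<lambda>\<omega>. ?g (restrict (\<lambda>j. \<xi> j \<omega>) {s + 1..s + 1})"
  let ?P = "Pi\<^sub>M {1..s} (\<lambda>_. count_space (UNIV :: int set))"
  have [measurable]: "Measurable.pred ?P (\<lambda>f. enat s < T_mu (\<lambda>j f. f j) \<mu> f)"
    by (intro measurable_less_T_mu measurable_coordinate)
  have [measurable]: "walk_max (\<lambda>j f. f j) s \<in> measurable ?P (count_space UNIV)"
    by (intro measurable_walk_max measurable_coordinate)
  have f: "?f \<in> borel_measurable ?P" by measurable
  have g: "?g \<in> borel_measurable (Pi\<^sub>M {s + 1..s + 1} (\<lambda>_. count_space UNIV))"
    by (rule measurable_compose[OF measurable_coordinate]) auto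
  have indep: "indep_var borel ?past borel ?next" by (rule indep_past_future[OF f g])
  have step: "?next = (\<lambda>\<omega>. real_of_int (\<xi> (Suc s) \<omega>))" by simp
  have past: "integrable M ?past"
  proof (rule integrable_const_bound[of _ 1])
    show "?past \<in> borel_measurable M" using indep by (rule indep_var_rv1)
  qed auto
  have gain: "gain i s = (\<lambda>\<omega>. ?past \<omega> * ?next \<omega>)"
    unfolding step by (auto simp: gain_def fun_eq_iff less_T_restrict[of s] walk_max_restrict[of s])
  show "integrable M (gain i s)"
    unfolding gain by (rule indep_var_integrable[OF indep past]) (simp add: step integrable_step)
  have "expectation (gain i s) = expectation ?past * expectation ?next"
    unfolding gain by (rule indep_var_lebesgue_integral[OF indep past]) (simp add: step integrable_step)
  also have "expectation ?next = 0" unfolding step using expectation_step[of "Suc s"] symmetric by simp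
  finally show "expectation (gain i s) = 0" by simp
qed

text \<open>The Azema--Yor sum evaluated at the stopping time, where the maximum is the level of the position.
  Comparing levels is the same as comparing support points.\<close>

lemma sum_gain:
  assumes path: "unit_steps \<xi> \<omega>" and k: "T \<omega> = enat k" and x: "x \<in> supp" and "k \<le> n"
  shows "(\<Sum>s<n. gain (int (level x)) s \<omega>) =
    (if x < terminal \<omega> then 1 else if terminal \<omega> = x then real_of_int x - level x else 0)"
proof -
  have "(\<Sum>s<n. gain (int (level x)) s \<omega>) = (\<Sum>s<k. gain (int (level x)) s \<omega>)"
    using \<open>k \<le> n\<close> by (intro sum.mono_neutral_right) (auto simp: gain_def k)
  also have "\<dots> = real_of_int (\<Sum>s<k. if walk_max \<xi> s \<omega> = int (level x) then \<xi> (Suc s) \<omega> else 0)"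
    unfolding of_int_sum by (intro sum.cong) (auto simp: gain_def k)
  also have "\<dots> = (if level x < level (terminal \<omega>) then 1
      else if level (terminal \<omega>) = level x then real_of_int (terminal \<omega>) - level x else 0)"
    using azema_yor_path[OF path, of "int (level x)" k] terminal_stops[OF k]
    by (simp add: terminal_def k)
  also have "\<dots> = (if x < terminal \<omega> then 1 else if terminal \<omega> = x then real_of_int x - level x else 0)"
    using terminal_stops[OF k] x level_less[of x "terminal \<omega>"] level_less[of "terminal \<omega>" x]
    by (cases x "terminal \<omega>" rule: linorder_cases) auto
  finally show ?thesis .
qed

lemma abs_sum_gain_le_duration:
  assumes path: "unit_steps \<xi> \<omega>" and k: "T \<omega> = enat k"
  shows "\<bar>\<Sum>s<n. gain i s \<omega>\<bar> \<le> duration \<omega>"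
proof -
  have "\<bar>\<Sum>s<n. gain i s \<omega>\<bar> \<le> (\<Sum>s<n. \<bar>gain i s \<omega>\<bar>)" by (rule sum_abs)
  also have "\<dots> \<le> (\<Sum>s<n. if s < k then 1 else 0)"
  proof (rule sum_mono)
    fix s
    have "\<xi> (Suc s) \<omega> \<in> {-1, 0, 1}" using path by (auto simp: unit_steps_def)
    then show "\<bar>gain i s \<omega>\<bar> \<le> (if s < k then 1 else 0)" by (auto simp: gain_def k)
  qed
  also have "\<dots> = card ({..<n} \<inter> {..<k})" by (simp add: sum.If_cases lessThan_def)
  also have "\<dots> \<le> duration \<omega>" using card_mono[of "{..<k}" "{..<n} \<inter> {..<k}"] by (simp add: duration_def k)
  finally show ?thesis .
qed

text \<open>Optional stopping for the total gain: its partial sums have mean zero and are dominated by the stopping time.\<close>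

lemma terminal_overshoot:
  assumes x: "x \<in> supp"
  shows "(psi \<mu> x - real_of_int x) * prob {\<omega> \<in> space M. terminal \<omega> = x} = prob {\<omega> \<in> space M. x < terminal \<omega>}"
proof -
  let ?f = "\<lambda>\<omega>. indicat_real {\<omega> \<in> space M. x < terminal \<omega>} \<omega> -
    (psi \<mu> x - x) * indicat_real {\<omega> \<in> space M. terminal \<omega> = x} \<omega>"
  have "(\<lambda>n. expectation (\<lambda>\<omega>. \<Sum>s<n. gain (int (level x)) s \<omega>)) \<longlonglongrightarrow> expectation ?f"
  proof (rule integral_dominated_convergence[OF _ _ integrable_duration])
    show "?f \<in> borel_measurable M" by measurable
    show "(\<lambda>\<omega>. \<Sum>s<n. gain (int (level x)) s \<omega>) \<in> borel_measurable M" for n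
      using integrable_gain by (intro borel_measurable_sum) auto
    show "AE \<omega> in M. (\<lambda>n. \<Sum>s<n. gain (int (level x)) s \<omega>) \<longlonglongrightarrow> ?f \<omega>"
      using AE_unit_steps AE_T_finite AE_space
    proof eventually_elim
      case (elim \<omega>)
      then obtain k where k: "T \<omega> = enat k" by auto
      have "(\<Sum>s<n. gain (int (level x)) s \<omega>) = ?f \<omega>" if "k \<le> n" for n
        using sum_gain[OF elim(1) k x that] elim(3) by (auto simp: psi_eq_level[OF x])
      then show ?case by (intro tendsto_eventually) (auto simp: eventually_sequentially)
    qed
    show "AE \<omega> in M. norm (\<Sum>s<n. gain (int (level x)) s \<omega>) \<le> duration \<omega>" for n
      using AE_unit_steps AE_T_finite
      by eventually_elim (auto intro: abs_sum_gain_le_duration)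
  qed
  then have zero: "expectation ?f = 0"
    using integrable_gain expectation_gain by (simp add: LIMSEQ_const_iff)
  have ind: "integrable M (indicat_real {\<omega> \<in> space M. P (terminal \<omega>)})" for P
    by (intro integrable_real_indicator) (auto simp: emeasure_eq_measure)
  have "expectation ?f = prob {\<omega> \<in> space M. x < terminal \<omega>} -
      (psi \<mu> x - x) * prob {\<omega> \<in> space M. terminal \<omega> = x}"
    by (subst Bochner_Integration.integral_diff) (simp_all add: ind[of "\<lambda>z. z = x"] ind[of "\<lambda>z. x < z"])
  with zero show ?thesis by simp
qed

lemma distr_terminal: "distr M (count_space UNIV) terminal = measure_pmf \<mu>"
proof -
  let ?N = "distr M (count_space UNIV) terminal"
  interpret N: prob_space ?N by (rule prob_space_distr) measurable
  have "AE x in ?N. measure ?N {x} \<noteq> 0"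
    by (subst N.AE_support_countable) (auto intro: exI[of _ UNIV])
  then obtain \<nu> where \<nu>: "measure_pmf \<nu> = ?N"
    using Abs_pmf_inverse[of ?N] N.prob_space_axioms by auto
  have prob_\<nu>: "measure_pmf.prob \<nu> A = prob {\<omega> \<in> space M. terminal \<omega> \<in> A}" for A
    unfolding \<nu> by (subst measure_distr) (auto simp: vimage_def Int_def conj_commute)
  have "AE x in measure_pmf \<nu>. x \<in> supp"
    unfolding \<nu> using AE_terminal_in_supp by (subst AE_distr_iff) auto
  then have "set_pmf \<nu> \<subseteq> supp" by (auto simp: AE_measure_pmf_iff)
  moreover have "(psi \<mu> x - real_of_int x) * pmf \<nu> x = measure_pmf.prob \<nu> {x + 1..}" if "x \<in> supp" for x
    using terminal_overshoot[OF that] by (simp add: prob_\<nu> pmf.rep_eq add1_zle_eq)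
  ultimately have "\<nu> = \<mu>" by (rule pmf_eqI_overshoot)
  with \<nu> show ?thesis by simp
qed

end

section \<open>The embedding theorem\<close>

theorem proposition5:
  fixes M :: "'a measure" and \<xi> :: "nat \<Rightarrow> 'a \<Rightarrow> int" and p q r :: real and \<mu> :: "int pmf"
  assumes "random_walk_steps M \<xi> p q r"
    and "p = q"
    and "centered \<mu>"
    and A1: "psi \<mu> ` set_pmf \<mu> \<subseteq> \<nat>"
    and A2: "strict_mono_on (set_pmf \<mu>) (psi \<mu>)"
  shows "(\<integral>\<^sup>+ \<omega>. ennreal_of_enat (T_mu \<xi> \<mu> \<omega>) \<partial>M) < \<infinity> \<and>
         uniformly_integrable M (\<lambda>t \<omega>. real_of_int (stopped \<xi> (T_mu \<xi> \<mu>) t \<omega>)) \<and>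
         embeds M \<xi> (T_mu \<xi> \<mu>) \<mu>"
proof -
  interpret symmetric_walk_embedding M \<xi> p q r \<mu>
    using assms by (intro symmetric_walk_embedding.intro admissible_target.intro symmetric_walk_embedding_axioms.intro)
  have "embeds M \<xi> (T_mu \<xi> \<mu>) \<mu>"
    unfolding embeds_def using AE_T_finite measurable_terminal distr_terminal
    by (simp add: terminal_def[abs_def])
  then show ?thesis using nn_integral_T_finite uniformly_integrable_stopped by blast
qed

end
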